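(* Let $M=(E,\mathcal{I})$ be a matroid with $m=|E|\ge1$ elements, no loops and rank function $r$, let $\rho=\rho(M)$, and let $0<\rho^-\le\rho^+$ (allowing $\rho^-=0$, $\rho^+=+\infty$ with $2/\rho^-=+\infty$) be such that $\rho\in[\rho^-,\rho^+]$. Run greedy base packing with pruning with interval $[\rho^-,\rho^+]$. Then for every $k\ge1$, $\rho(M_k)=\rho$. Furthermore, if $\varepsilon\in(0,1]$ and $k\ge\frac{20\rho\log m}{\varepsilon^2}$, then $$0\le\frac{1}{\min_{e\in E_k}x^k_e}-\rho\le\varepsilon\rho.$$
   Context: For a matroid $N$ with ground set $F$ and rank function $r_N$, $\rho(N)=\max_{\varnothing\neq H\subseteq F}\frac{|H|}{r_N(H)}$. Greedy base packing with pruning: set $E_1=E$ and $x^0=\mathbf 0$. For $k=1,2,\ldots$: let $M_k=M|E_k$ (restriction of $M$ to $E_k$); let $B_k$ be a minimum-weight base of $M_k$ with respect to the weights $x^{k-1}$ (ties arbitrary); define $x^k\in[0,1]^{E_k}$ by $x^k_e=\frac1k|\{j\le k: e\in B_j\}|$; and set $E_{k+1}=E_k\setminus\{e\in E_k: x^k_e>2/\rho^- \text{ and } k\ge 24\rho^+\log m\}$. $\log$ is the natural logarithm. *)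

theory Defs
  imports Complex_Main "HOL-Library.Extended_Real"
begin

locale matroid =
  fixes E :: "'a set" and \<I> :: "'a set set"
  assumes finite_ground: "finite E"
    and indep_subset_ground: "X \<in> \<I> \<Longrightarrow> X \<subseteq> E"
    and empty_indep: "{} \<in> \<I>"
    and indep_subset: "X \<in> \<I> \<Longrightarrow> Y \<subseteq> X \<Longrightarrow> Y \<in> \<I>"
    and augmentation: "X \<in> \<I> \<Longrightarrow> Y \<in> \<I> \<Longrightarrow> card X < card Y \<Longrightarrow> \<exists>e\<in>Y - X. insert e X \<in> \<I>"

definition matroid_loop :: "'a set \<Rightarrow> 'a set set \<Rightarrow> 'a \<Rightarrow> bool" where
  "matroid_loop E \<I> e \<longleftrightarrow> e \<in> E \<and> {e} \<notin> \<I>"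

definition matroid_rank :: "'a set set \<Rightarrow> 'a set \<Rightarrow> nat" where
  "matroid_rank \<I> H = Max (card ` {X \<in> \<I>. X \<subseteq> H})"

definition matroid_base :: "'a set set \<Rightarrow> 'a set \<Rightarrow> bool" where
  "matroid_base \<I> B \<longleftrightarrow> B \<in> \<I> \<and> (\<forall>X\<in>\<I>. B \<subseteq> X \<longrightarrow> X = B)"

(* The independent sets of the restriction M|F; its ground set is F. *)
definition restrict_indep :: "'a set set \<Rightarrow> 'a set \<Rightarrow> 'a set set" where
  "restrict_indep \<I> F = {X \<in> \<I>. X \<subseteq> F}"

(* If the matroid has no loops, the rank of every nonempty H is positive, so no division by
   zero occurs. *)
definition matroid_density :: "'a set \<Rightarrow> 'a set set \<Rightarrow> real" where
  "matroid_density F \<I> = Max {real (card H) / real (matroid_rank \<I> H) | H. H \<noteq> {} \<and> H \<subseteq> F}"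

definition min_weight_base :: "'a set set \<Rightarrow> ('a \<Rightarrow> real) \<Rightarrow> 'a set \<Rightarrow> bool" where
  "min_weight_base \<I> w B \<longleftrightarrow>
     matroid_base \<I> B \<and> (\<forall>B'. matroid_base \<I> B' \<longrightarrow> sum w B \<le> sum w B')"

(* The vector x^k, as a total function that is only evaluated on the current ground set.
   For k = 0 it is the zero vector, because 0 / 0 = 0. *)
definition packing_load :: "(nat \<Rightarrow> 'a set) \<Rightarrow> nat \<Rightarrow> 'a \<Rightarrow> real" where
  "packing_load B k e = real (card {j \<in> {1..k}. e \<in> B j}) / real k"

(* Es and B are the sequences of ground sets and of bases, indexed from 1 (the values at 0 are
   irrelevant), of some run of the algorithm; being a relation, it admits every way of breaking
   ties. The bounds lo and hi on the density are extended reals, where 2 / 0 = \<infinity>. *)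
definition pruned_greedy_packing ::
    "'a set \<Rightarrow> 'a set set \<Rightarrow> ereal \<Rightarrow> ereal \<Rightarrow> (nat \<Rightarrow> 'a set) \<Rightarrow> (nat \<Rightarrow> 'a set) \<Rightarrow> bool" where
  "pruned_greedy_packing E \<I> lo hi Es B \<longleftrightarrow>
     Es 1 = E \<and>
     (\<forall>k\<ge>1.
        min_weight_base (restrict_indep \<I> (Es k)) (packing_load B (k - 1)) (B k) \<and>
        Es (k + 1) = Es k - {e \<in> Es k. ereal (packing_load B k e) > 2 / lo \<and>
                                        ereal (real k) \<ge> 24 * hi * ereal (ln (real (card E)))})"

end

theory Submission
  imports Defs "HOL-Analysis.Harmonic_Numbers"
begin

text \<open>Two multiplicative-weights potentials control the loads. A minimum-weight base meets every
sublevel set of the weights in a set of full rank, so for any decreasing function of the load it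
collects at least a \<open>1/\<rho>\<close> share of the total; hence the sum of \<open>(1 - \<delta>)\<^bsup>L(e)\<^esup>\<close> over the
current ground set, where \<open>L(e)\<close> is the number of bases containing \<open>e\<close>, shrinks by a
factor \<open>1 - \<delta>/\<rho>\<close> in each round, which bounds the loads from below. For a densest set \<open>U\<close>,
submodularity shows in the same way that the sum of \<open>2\<^bsup>L(e)\<^esup>\<close> over \<open>U\<close> grows by at most a factor
\<open>1 + 1/\<rho>\<close>, so that no element of \<open>U\<close> ever reaches the pruning threshold. As \<open>U\<close> survives, the
density stays \<open>\<rho>\<close> and the minimum load is at most the average load on \<open>U\<close>, which is at
most \<open>1/\<rho>\<close>.\<close>

section \<open>Rank and minimum-weight bases\<close>

context matroid
begin

lemma finite_indep: "X \<in> \<I> \<Longrightarrow> finite X"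
  using indep_subset_ground finite_ground finite_subset by blast

lemma finite_indeps: "finite {X \<in> \<I>. P X}"
  by (rule finite_subset[of _ "Pow E"]) (use indep_subset_ground finite_ground in auto)

lemma card_le_rank: "X \<in> \<I> \<Longrightarrow> X \<subseteq> H \<Longrightarrow> card X \<le> matroid_rank \<I> H"
  unfolding matroid_rank_def using finite_indeps by (intro Max_ge) auto

lemma rank_attained:
  obtains X where "X \<in> \<I>" "X \<subseteq> H" "card X = matroid_rank \<I> H"
proof -
  have "matroid_rank \<I> H \<in> card ` {X \<in> \<I>. X \<subseteq> H}"
    unfolding matroid_rank_def using finite_indeps empty_indep by (intro Max_in) auto
  then show ?thesis using that by force
qed

lemma rank_le_card: "finite H \<Longrightarrow> matroid_rank \<I> H \<le> card H"
  by (metis rank_attained card_mono)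

text \<open>Augmenting \<open>X\<close> repeatedly from \<open>Y\<close> stops exactly at size
  \<open>card Y\<close>. The bound \<open>Z \<subseteq> X \<union> Y\<close> serves below to control
  which elements an exchange brings in.\<close>

lemma extend_indep:
  assumes "X \<in> \<I>" "Y \<in> \<I>" "card X \<le> card Y"
  obtains Z where "Z \<in> \<I>" "X \<subseteq> Z" "Z \<subseteq> X \<union> Y" "card Z = card Y"
proof -
  have "\<exists>Z\<in>\<I>. X \<subseteq> Z \<and> Z \<subseteq> X \<union> Y \<and> card Z = card Y"
    using assms
  proof (induction "card Y - card X" arbitrary: X)
    case 0
    then show ?case by auto
  next
    case (Suc n)
    then have "card X < card Y" by simp
    then obtain e where e: "e \<in> Y - X" "insert e X \<in> \<I>"
      using augmentation Suc.prems by blast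
    have "card (insert e X) = Suc (card X)"
      using e Suc.prems finite_indep by simp
    then have "\<exists>Z\<in>\<I>. insert e X \<subseteq> Z \<and> Z \<subseteq> insert e X \<union> Y \<and> card Z = card Y"
      using Suc.hyps(2) Suc.prems e by (intro Suc.hyps(1)) auto
    then show ?case using e by blast
  qed
  then show ?thesis using that by blast
qed

text \<open>A largest independent subset \<open>X\<close> of the intersection extends to a largest
  one \<open>Z\<close> of the union. Both \<open>Z \<inter> A\<close> and
  \<open>Z \<inter> C\<close> are independent and contain \<open>X\<close>, so inclusion-exclusion
  counts \<open>X\<close> twice.\<close>

lemma rank_submodular:
  "matroid_rank \<I> (A \<union> C) + matroid_rank \<I> (A \<inter> C) \<le> matroid_rank \<I> A + matroid_rank \<I> C"
proof -
  obtain X where X: "X \<in> \<I>" "X \<subseteq> A \<inter> C" "card X = matroid_rank \<I> (A \<inter> C)"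
    by (rule rank_attained)
  obtain Y where Y: "Y \<in> \<I>" "Y \<subseteq> A \<union> C" "card Y = matroid_rank \<I> (A \<union> C)"
    by (rule rank_attained)
  have "card X \<le> card Y"
    using card_le_rank[of X "A \<union> C"] X Y by auto
  then obtain Z where Z: "Z \<in> \<I>" "X \<subseteq> Z" "Z \<subseteq> X \<union> Y" "card Z = card Y"
    using extend_indep X Y by metis
  have fin: "finite Z" by (rule finite_indep[OF Z(1)])
  have "card Z + card X \<le> card ((Z \<inter> A) \<union> (Z \<inter> C)) + card ((Z \<inter> A) \<inter> (Z \<inter> C))"
    using fin X Y Z by (intro add_mono card_mono) auto
  also have "\<dots> = card (Z \<inter> A) + card (Z \<inter> C)"
    using fin card_Un_Int[of "Z \<inter> A" "Z \<inter> C"] by simp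
  also have "\<dots> \<le> matroid_rank \<I> A + matroid_rank \<I> C"
    using Z indep_subset by (intro add_mono card_le_rank) auto
  finally show ?thesis using X Y Z by simp
qed

text \<open>By augmentation, maximal under inclusion is the same as maximum in size. Exchange
  arguments thus only have to check cardinalities.\<close>

lemma base_restrict_iff:
  "matroid_base (restrict_indep \<I> F) B \<longleftrightarrow> B \<in> \<I> \<and> B \<subseteq> F \<and> card B = matroid_rank \<I> F"
proof
  assume base: "matroid_base (restrict_indep \<I> F) B"
  then have B: "B \<in> \<I>" "B \<subseteq> F"
    by (auto simp: matroid_base_def restrict_indep_def)
  obtain X where X: "X \<in> \<I>" "X \<subseteq> F" "card X = matroid_rank \<I> F"
    by (rule rank_attained)
  have "\<not> card B < card X"
  proof
    assume "card B < card X"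
    then obtain e where "e \<in> X - B" "insert e B \<in> \<I>"
      using augmentation B X by blast
    then show False
      using base B X by (auto simp: matroid_base_def restrict_indep_def)
  qed
  then show "B \<in> \<I> \<and> B \<subseteq> F \<and> card B = matroid_rank \<I> F"
    using B X card_le_rank[of B F] by auto
next
  assume B: "B \<in> \<I> \<and> B \<subseteq> F \<and> card B = matroid_rank \<I> F"
  have "X = B" if "X \<in> \<I>" "X \<subseteq> F" "B \<subseteq> X" for X
    using that B card_le_rank[of X F] finite_indep card_seteq by metis
  with B show "matroid_base (restrict_indep \<I> F) B"
    by (auto simp: matroid_base_def restrict_indep_def)
qed

text \<open>Otherwise \<open>B \<inter> S\<close> could be augmented by some \<open>e\<close> in
  \<open>S\<close>. Completing the result from \<open>B\<close> gives a base that trades an element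
  outside \<open>S\<close> for the strictly lighter \<open>e\<close>.\<close>

lemma min_weight_base_sublevel_rank:
  assumes B: "min_weight_base (restrict_indep \<I> F) w B"
    and S: "S \<subseteq> F" "\<And>e f. e \<in> S \<Longrightarrow> f \<in> F - S \<Longrightarrow> w e < (w f :: real)"
  shows "card (B \<inter> S) = matroid_rank \<I> S"
proof (rule ccontr)
  have base: "B \<in> \<I>" "B \<subseteq> F" "card B = matroid_rank \<I> F"
    using B by (auto simp: min_weight_base_def base_restrict_iff)
  have BS: "B \<inter> S \<in> \<I>"
    using base indep_subset by blast
  obtain X where X: "X \<in> \<I>" "X \<subseteq> S" "card X = matroid_rank \<I> S"
    by (rule rank_attained)
  assume "card (B \<inter> S) \<noteq> matroid_rank \<I> S"
  then have "card (B \<inter> S) < card X"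
    using card_le_rank[OF BS, of S] X by auto
  then obtain e where e: "e \<in> X - B \<inter> S" "insert e (B \<inter> S) \<in> \<I>"
    using augmentation BS X by blast
  have "card (insert e (B \<inter> S)) \<le> card B"
    using card_le_rank[OF e(2), of F] base e X S by auto
  then obtain Z where Z: "Z \<in> \<I>" "insert e (B \<inter> S) \<subseteq> Z" "Z \<subseteq> insert e (B \<inter> S) \<union> B"
      "card Z = card B"
    using extend_indep[OF e(2) base(1)] by blast
  have eB: "e \<notin> B" "e \<in> S"
    using e X by auto
  have fin: "finite B" "finite Z"
    using base Z finite_indep by auto
  \<comment> \<open>\<open>Z\<close> lies in \<open>insert e B\<close> and is smaller by one, so the
    exchange drops a single element. It is outside \<open>S\<close> because \<open>Z\<close> keeps
    all of \<open>B \<inter> S\<close>.\<close>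
  have "card (insert e B - Z) = 1"
    using fin Z eB by (subst card_Diff_subset) auto
  then obtain f where f: "insert e B - Z = {f}"
    using card_1_singletonE by blast
  then have fB: "f \<in> B" "f \<notin> S" and Z_eq: "Z = insert e (B - {f})"
    using Z eB by auto
  have "sum w Z = w e + (sum w B - w f)"
    using fB eB fin unfolding Z_eq by (simp add: sum_diff1)
  also have "\<dots> < sum w B"
    using S(2)[of e f] fB eB base by auto
  finally have "sum w Z < sum w B" .
  moreover have "matroid_base (restrict_indep \<I> F) Z"
    using Z base eB S by (auto simp: base_restrict_iff)
  ultimately show False
    using B by (force simp: min_weight_base_def)
qed

end

section \<open>Rank and density under restriction\<close>

lemma rank_restrict: "H \<subseteq> F \<Longrightarrow> matroid_rank (restrict_indep \<I> F) H = matroid_rank \<I> H"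
  unfolding matroid_rank_def restrict_indep_def
  by (rule arg_cong[where f = "\<lambda>A. Max (card ` A)"]) auto

lemma matroid_density_image:
  "matroid_density F \<I> = Max ((\<lambda>H. real (card H) / real (matroid_rank \<I> H)) ` (Pow F - {{}}))"
  unfolding matroid_density_def by (rule arg_cong[where f = Max]) auto

lemma density_restrict: "matroid_density F (restrict_indep \<I> F) = matroid_density F \<I>"
  unfolding matroid_density_image
  by (intro arg_cong[where f = Max] image_cong) (auto simp: rank_restrict)

lemma density_ge:
  assumes "finite F" "H \<noteq> {}" "H \<subseteq> F"
  shows "real (card H) / real (matroid_rank \<I> H) \<le> matroid_density F \<I>"
  unfolding matroid_density_image using assms by (intro Max_ge) auto

lemma density_attained:
  assumes "finite F" "F \<noteq> {}"
  obtains U where "U \<noteq> {}" "U \<subseteq> F" "real (card U) / real (matroid_rank \<I> U) = matroid_density F \<I>"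
proof -
  have "matroid_density F \<I> \<in> (\<lambda>H. real (card H) / real (matroid_rank \<I> H)) ` (Pow F - {{}})"
    unfolding matroid_density_image using assms by (intro Max_in) auto
  then obtain U where "matroid_density F \<I> = real (card U) / real (matroid_rank \<I> U)"
      "U \<in> Pow F - {{}}"
    by (rule imageE)
  then show ?thesis using that[of U] by simp
qed

section \<open>Potentials of the loads\<close>

lemma sum_weighted_nonneg:
  fixes d w :: "'a \<Rightarrow> real"
  assumes "finite A" "\<And>e. e \<in> A \<Longrightarrow> 0 \<le> w e" "\<And>t. 0 \<le> (\<Sum>e\<in>{e\<in>A. w e > t}. d e)"
  shows "0 \<le> (\<Sum>e\<in>A. d e * w e)"
  using assms
proof (induction A arbitrary: w rule: finite_psubset_induct)
  case (psubset A)
  show ?case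
  proof (cases "A = {}")
    case False
    define t where "t = Min (w ` A)"
    have t: "t \<le> w e" if "e \<in> A" for e
      using psubset.hyps that by (simp add: t_def)
    have "t \<in> w ` A"
      unfolding t_def using psubset.hyps False by (intro Min_in) auto
    then obtain a where a: "a \<in> A" "w a = t" by auto
    define A' where "A' = {e\<in>A. w e > t}"
    have "A' \<subset> A" using a by (auto simp: A'_def)
    moreover have "0 \<le> (\<Sum>e\<in>{e\<in>A'. w e - t > s}. d e)" for s
    proof -
      \<comment> \<open>The maximum covers negative \<open>s\<close>, where membership in
        \<open>A'\<close> is the binding condition.\<close>
      have "{e\<in>A'. w e - t > s} = {e\<in>A. w e > max t (t + s)}"
        by (auto simp: A'_def)
      then show ?thesis using psubset.prems by metis
    qed
    ultimately have "0 \<le> (\<Sum>e\<in>A'. d e * (w e - t))"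
      by (intro psubset.IH) (auto simp: A'_def)
    also have "\<dots> = (\<Sum>e\<in>A. d e * (w e - t))"
      using psubset.hyps t by (intro sum.mono_neutral_left) (force simp: A'_def)+
    finally have 1: "0 \<le> (\<Sum>e\<in>A. d e * (w e - t))" .
    \<comment> \<open>Any threshold below the minimum yields all of \<open>A\<close>, hence a
      nonnegative total of \<open>d\<close>.\<close>
    have "{e\<in>A. w e > t - 1} = A" using t by force
    then have "0 \<le> (\<Sum>e\<in>A. d e)" using psubset.prems(2)[of "t - 1"] by simp
    moreover have "0 \<le> t" using a psubset.prems by auto
    ultimately have "0 \<le> t * (\<Sum>e\<in>A. d e)" by simp
    with 1 have "0 \<le> (\<Sum>e\<in>A. d e * (w e - t)) + t * (\<Sum>e\<in>A. d e)" by simp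
    also have "\<dots> = (\<Sum>e\<in>A. d e * w e)"
      by (simp add: sum_distrib_left algebra_simps flip: sum.distrib)
    finally show ?thesis .
  qed simp
qed

lemma sum_indicator_card:
  "finite A \<Longrightarrow> (\<Sum>e\<in>A. of_bool (e \<in> B) - c) = real (card (B \<inter> A)) - c * real (card A)"
  by (simp add: sum_subtractf Int_commute mult.commute)

text \<open>Superlevel sets of \<open>w\<close> are sublevel sets of \<open>x\<close>, where
  \<open>B\<close> has full rank and hence at least a \<open>c\<close> share of the elements. The
  layer-cake lemma turns this into the weighted inequality.\<close>

lemma (in matroid) min_weight_base_antitone_sum:
  assumes B: "min_weight_base (restrict_indep \<I> F) x B" and "F \<subseteq> E"
    and dens: "\<And>H. H \<subseteq> F \<Longrightarrow> c * real (card H) \<le> real (matroid_rank \<I> H)"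
    and w: "\<And>e. e \<in> F \<Longrightarrow> 0 \<le> w e"
    and anti: "\<And>e f. e \<in> F \<Longrightarrow> f \<in> F \<Longrightarrow> w f < w e \<Longrightarrow> x e < x f"
  shows "c * (\<Sum>e\<in>F. w e) \<le> (\<Sum>e\<in>F. of_bool (e \<in> B) * w e)"
proof -
  have fin: "finite F" using \<open>F \<subseteq> E\<close> finite_ground finite_subset by blast
  have "0 \<le> (\<Sum>e\<in>F. (of_bool (e \<in> B) - c) * w e)"
  proof (rule sum_weighted_nonneg[OF fin w])
    fix t
    let ?S = "{e \<in> F. t < w e}"
    have "card (B \<inter> ?S) = matroid_rank \<I> ?S"
      by (rule min_weight_base_sublevel_rank[OF B]) (auto intro!: anti)
    then show "0 \<le> (\<Sum>e\<in>?S. of_bool (e \<in> B) - c)"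
      using dens[of ?S] fin by (subst sum_indicator_card) auto
  qed
  then show ?thesis
    by (simp add: left_diff_distrib sum_subtractf flip: sum_distrib_left)
qed

text \<open>Superlevel sets of \<open>w\<close> are now complements of sublevel sets of
  \<open>x\<close>. As \<open>B\<close> spends full rank on the sublevel set, it has only the
  marginal rank of \<open>U\<close> left for the rest. Submodularity and tightness of
  \<open>U\<close> bound this by a \<open>c\<close> share.\<close>

lemma (in matroid) min_weight_base_monotone_sum:
  assumes B: "min_weight_base (restrict_indep \<I> F) x B" and "F \<subseteq> E" and "U \<subseteq> F"
    and dens: "\<And>H. H \<subseteq> U \<Longrightarrow> c * real (card H) \<le> real (matroid_rank \<I> H)"
    and tight: "c * real (card U) = real (matroid_rank \<I> U)"
    and w: "\<And>e. e \<in> U \<Longrightarrow> 0 \<le> w e"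
    and mono: "\<And>e f. e \<in> F \<Longrightarrow> f \<in> F \<Longrightarrow> w e < w f \<Longrightarrow> x e < x f"
  shows "(\<Sum>e\<in>U. of_bool (e \<in> B) * w e) \<le> c * (\<Sum>e\<in>U. w e)"
proof -
  have fin: "finite F" "finite U"
    using \<open>F \<subseteq> E\<close> \<open>U \<subseteq> F\<close> finite_ground finite_subset by (meson)+
  have base: "B \<in> \<I>" "B \<subseteq> F"
    using B by (auto simp: min_weight_base_def base_restrict_iff)
  have "0 \<le> (\<Sum>e\<in>U. - (of_bool (e \<in> B) - c) * w e)"
  proof (rule sum_weighted_nonneg[OF fin(2) w])
    fix t
    \<comment> \<open>The sublevel set is taken in all of \<open>F\<close>, because \<open>B\<close>
      is optimal there and not within \<open>U\<close>.\<close>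
    let ?S = "{e \<in> F. \<not> t < w e}" and ?T = "{e \<in> U. t < w e}"
    have U: "U \<inter> ?S \<union> ?T = U" "U \<inter> ?S \<inter> ?T = {}" using \<open>U \<subseteq> F\<close> by auto
    have "card (B \<inter> ?S) = matroid_rank \<I> ?S"
      by (rule min_weight_base_sublevel_rank[OF B]) (auto intro!: mono)
    moreover have "card (B \<inter> (U \<union> ?S)) = card (B \<inter> ?T) + card (B \<inter> ?S)"
      using fin \<open>U \<subseteq> F\<close> by (subst card_Un_disjoint[symmetric]) (auto intro: arg_cong[where f = card])
    moreover have "card (B \<inter> (U \<union> ?S)) \<le> matroid_rank \<I> (U \<union> ?S)"
      using base indep_subset by (intro card_le_rank) auto
    moreover have "matroid_rank \<I> (U \<union> ?S) + matroid_rank \<I> (U \<inter> ?S)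
        \<le> matroid_rank \<I> U + matroid_rank \<I> ?S"
      by (rule rank_submodular)
    ultimately have "card (B \<inter> ?T) + matroid_rank \<I> (U \<inter> ?S) \<le> matroid_rank \<I> U"
      by linarith
    then have "real (card (B \<inter> ?T)) + real (matroid_rank \<I> (U \<inter> ?S)) \<le> c * real (card U)"
      using tight by linarith
    moreover have "card U = card (U \<inter> ?S) + card ?T"
      using card_Un_disjoint[of "U \<inter> ?S" ?T] fin U by simp
    moreover have "c * real (card (U \<inter> ?S)) \<le> real (matroid_rank \<I> (U \<inter> ?S))"
      by (rule dens) auto
    ultimately have "real (card (B \<inter> ?T)) \<le> c * real (card ?T)"
      by (simp add: distrib_left)
    then show "0 \<le> (\<Sum>e\<in>?T. - (of_bool (e \<in> B) - c))"
      using fin by (simp only: sum_negf) (subst sum_indicator_card, auto)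
  qed
  then show ?thesis
    by (simp add: left_diff_distrib sum_subtractf flip: sum_distrib_left)
qed

section \<open>Multiplicities, the integer form of the loads, and their potentials\<close>

definition multiplicity_count :: "(nat \<Rightarrow> 'a set) \<Rightarrow> nat \<Rightarrow> 'a \<Rightarrow> nat" where
  "multiplicity_count B k e = card {j \<in> {1..k}. e \<in> B j}"

lemma multiplicity_count_0 [simp]: "multiplicity_count B 0 e = 0"
  by (simp add: multiplicity_count_def)

lemma multiplicity_count_Suc:
  "multiplicity_count B (Suc k) e = multiplicity_count B k e + of_bool (e \<in> B (Suc k))"
proof -
  have "{j \<in> {1..Suc k}. e \<in> B j}
      = {j \<in> {1..k}. e \<in> B j} \<union> (if e \<in> B (Suc k) then {Suc k} else {})"
    by (auto simp: le_Suc_eq)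
  then show ?thesis by (simp add: multiplicity_count_def)
qed

lemma packing_load_eq: "packing_load B k e = real (multiplicity_count B k e) / real k"
  by (simp add: packing_load_def multiplicity_count_def)

lemma packing_load_less:
  "multiplicity_count B k e < multiplicity_count B k f \<Longrightarrow> packing_load B k e < packing_load B k f"
  by (cases "k = 0") (auto simp: packing_load_eq divide_strict_right_mono)

text \<open>Only the elements of the new base gain a factor \<open>q\<close>, so the increment is a
  weighted sum over that base, as bounded above. It is applied with \<open>q = 1 - \<delta>\<close>
  and with \<open>q = 2\<close>.\<close>

lemma potential_Suc:
  fixes q :: real
  shows "(\<Sum>e\<in>A. q ^ multiplicity_count B (Suc k) e) = (\<Sum>e\<in>A. q ^ multiplicity_count B k e)
     + (q - 1) * (\<Sum>e\<in>A. of_bool (e \<in> B (Suc k)) * q ^ multiplicity_count B k e)"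
  unfolding sum_distrib_left sum.distrib[symmetric]
  by (intro sum.cong) (auto simp: multiplicity_count_Suc algebra_simps)

lemma (in matroid) sum_multiplicity_count_le:
  assumes "finite A" "\<And>j. 1 \<le> j \<Longrightarrow> B j \<in> \<I>"
  shows "(\<Sum>e\<in>A. multiplicity_count B k e) \<le> k * matroid_rank \<I> A"
proof (induction k)
  case (Suc k)
  have "(\<Sum>e\<in>A. of_bool (e \<in> B (Suc k))) = card (B (Suc k) \<inter> A)"
    using assms(1) by (simp add: Int_commute)
  also have "\<dots> \<le> matroid_rank \<I> A"
    using assms(2)[of "Suc k"] indep_subset by (intro card_le_rank) auto
  finally show ?case using Suc by (simp add: multiplicity_count_Suc sum.distrib)
qed simp

section \<open>Runs of the algorithm\<close>

locale pruned_packing = matroid E \<I> for E :: "'a set" and \<I> :: "'a set set" +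
  fixes \<rho> :: real and lo hi :: ereal and Es B :: "nat \<Rightarrow> 'a set"
  assumes nonempty: "E \<noteq> {}"
    and loopless: "e \<in> E \<Longrightarrow> {e} \<in> \<I>"
    and density: "\<rho> = matroid_density E \<I>"
    and interval: "0 \<le> lo" "lo \<le> ereal \<rho>" "ereal \<rho> \<le> hi"
    and run: "pruned_greedy_packing E \<I> lo hi Es B"
begin

abbreviation "L \<equiv> multiplicity_count B"

section \<open>Consequences of the definition of a run\<close>

lemma card_ground_pos: "0 < card E"
  using nonempty finite_ground by (simp add: card_gt_0_iff)

lemma rank_pos: "H \<subseteq> E \<Longrightarrow> H \<noteq> {} \<Longrightarrow> 0 < matroid_rank \<I> H"
proof -
  assume "H \<subseteq> E" "H \<noteq> {}"
  then obtain e where "e \<in> H" "{e} \<in> \<I>" using loopless by blast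
  then show ?thesis using card_le_rank[of "{e}" H] by simp
qed

lemma density_ge_1: "1 \<le> \<rho>"
proof -
  have "1 \<le> real (card E) / real (matroid_rank \<I> E)"
    using rank_le_card[OF finite_ground] rank_pos[of E] nonempty by simp
  then show ?thesis
    using density_ge[OF finite_ground nonempty, of \<I>] density by simp
qed

lemma card_le_density: "H \<subseteq> E \<Longrightarrow> 1 / \<rho> * real (card H) \<le> real (matroid_rank \<I> H)"
  using density_ge[OF finite_ground, of H \<I>] rank_pos[of H] density density_ge_1
  by (cases "H = {}") (auto simp: field_simps)

lemma Es_1: "Es (Suc 0) = E"
  using run by (simp add: pruned_greedy_packing_def)

lemma B_min: "min_weight_base (restrict_indep \<I> (Es (Suc n))) (packing_load B n) (B (Suc n))"
  using run unfolding pruned_greedy_packing_def by (metis Suc_eq_plus1 add_diff_cancel_right' le_add2)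

lemma Es_Suc: "Es (Suc (Suc n)) = Es (Suc n) - {e \<in> Es (Suc n).
    2 / lo < ereal (packing_load B (Suc n) e) \<and>
    24 * hi * ereal (ln (real (card E))) \<le> ereal (real (Suc n))}"
  using run unfolding pruned_greedy_packing_def by (metis Suc_eq_plus1 le_add2)

lemma B_indep: "1 \<le> j \<Longrightarrow> B j \<in> \<I>"
  using B_min[of "j - 1"] by (auto simp: min_weight_base_def base_restrict_iff)

lemma Es_subset: "Es (Suc n) \<subseteq> E"
  by (induction n) (use Es_1 Es_Suc in auto)

text \<open>Since \<open>lo \<le> \<rho> \<le> hi\<close>, both pruning tests are at least as strict
  as the same tests with \<open>\<rho>\<close> in place of the bounds.\<close>

lemma pruned_imp:
  assumes "e \<in> Es (Suc n)" "e \<notin> Es (Suc (Suc n))"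
  shows "2 / \<rho> < packing_load B (Suc n) e" "24 * \<rho> * ln (real (card E)) \<le> real (Suc n)"
proof -
  have *: "2 / lo < ereal (packing_load B (Suc n) e)"
    "24 * hi * ereal (ln (real (card E))) \<le> ereal (real (Suc n))"
    using assms Es_Suc[of n] by auto
  have "ereal (2 / \<rho>) \<le> 2 / lo"
    \<comment> \<open>For \<open>lo = 0\<close> the right-hand side is infinite.\<close>
    using interval density_ge_1 by (cases lo) (auto simp: frac_le)
  also note *(1)
  finally show "2 / \<rho> < packing_load B (Suc n) e" by simp
  have "0 \<le> ln (real (card E))"
    using card_ground_pos by simp
  then have "24 * ereal \<rho> * ereal (ln (real (card E))) \<le> 24 * hi * ereal (ln (real (card E)))"
    using interval by (intro ereal_mult_right_mono ereal_mult_left_mono) auto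
  also note *(2)
  finally show "24 * \<rho> * ln (real (card E)) \<le> real (Suc n)" by simp
qed

text \<open>Each round removes at least a \<open>\<delta> / \<rho>\<close> share of the potential,
  and pruning only drops nonnegative terms. The first form drives the induction; the second, taken
  before pruning, bounds the loads on \<open>Es (Suc n)\<close>.\<close>

lemma low_potential:
  assumes "0 \<le> \<delta>" "\<delta> < 1"
  shows "(\<Sum>e\<in>Es (Suc n). (1 - \<delta>) ^ L n e) \<le> real (card E) * (1 - \<delta> / \<rho>) ^ n"
    and "(\<Sum>e\<in>Es (Suc n). (1 - \<delta>) ^ L (Suc n) e) \<le> real (card E) * (1 - \<delta> / \<rho>) ^ Suc n"
proof -
  have step: "(\<Sum>e\<in>Es (Suc n). (1 - \<delta>) ^ L (Suc n) e)
      \<le> (1 - \<delta> / \<rho>) * (\<Sum>e\<in>Es (Suc n). (1 - \<delta>) ^ L n e)" for n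
  proof -
    have less: "L n e < L n f" if "(1 - \<delta>) ^ L n f < (1 - \<delta>) ^ L n e" for e f
    proof (rule ccontr)
      assume "\<not> L n e < L n f"
      then have "(1 - \<delta>) ^ L n e \<le> (1 - \<delta>) ^ L n f"
        using assms by (intro power_decreasing) auto
      with that show False by simp
    qed
    have "1 / \<rho> * (\<Sum>e\<in>Es (Suc n). (1 - \<delta>) ^ L n e)
        \<le> (\<Sum>e\<in>Es (Suc n). of_bool (e \<in> B (Suc n)) * (1 - \<delta>) ^ L n e)"
      using assms Es_subset[of n]
      by (intro min_weight_base_antitone_sum[OF B_min Es_subset] card_le_density)
        (auto intro!: packing_load_less less)
    then have "\<delta> * (1 / \<rho> * (\<Sum>e\<in>Es (Suc n). (1 - \<delta>) ^ L n e))
        \<le> \<delta> * (\<Sum>e\<in>Es (Suc n). of_bool (e \<in> B (Suc n)) * (1 - \<delta>) ^ L n e)"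
      using assms by (intro mult_left_mono) auto
    then show ?thesis
      by (simp add: potential_Suc algebra_simps)
  qed
  have nonneg: "0 \<le> 1 - \<delta> / \<rho>"
    using assms density_ge_1 by simp
  show *: "(\<Sum>e\<in>Es (Suc n). (1 - \<delta>) ^ L n e) \<le> real (card E) * (1 - \<delta> / \<rho>) ^ n" for n
  proof (induction n)
    case (Suc n)
    have "(\<Sum>e\<in>Es (Suc (Suc n)). (1 - \<delta>) ^ L (Suc n) e)
        \<le> (\<Sum>e\<in>Es (Suc n). (1 - \<delta>) ^ L (Suc n) e)"
      using assms Es_Suc[of n] finite_subset[OF Es_subset finite_ground]
      by (intro sum_mono2) auto
    also note step
    also have "(1 - \<delta> / \<rho>) * (\<Sum>e\<in>Es (Suc n). (1 - \<delta>) ^ L n e)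
        \<le> (1 - \<delta> / \<rho>) * (real (card E) * (1 - \<delta> / \<rho>) ^ n)"
      using Suc nonneg by (rule mult_left_mono)
    finally show ?case by (simp add: mult_ac)
  qed (simp add: Es_1)
  show "(\<Sum>e\<in>Es (Suc n). (1 - \<delta>) ^ L (Suc n) e) \<le> real (card E) * (1 - \<delta> / \<rho>) ^ Suc n"
    using order.trans[OF step mult_left_mono[OF *[of n] nonneg]] by (simp add: mult_ac)
qed

text \<open>The single term of \<open>e\<close> is at most the whole potential, which decays
  exponentially. Taking logarithms forces the multiplicity of \<open>e\<close> to be large.\<close>

lemma load_lower_bound:
  assumes \<epsilon>: "0 < \<epsilon>" "\<epsilon> \<le> 1" and k: "20 * \<rho> * ln (real (card E)) / \<epsilon>\<^sup>2 \<le> real (Suc n)"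
    and e: "e \<in> Es (Suc n)"
  shows "1 / ((1 + \<epsilon>) * \<rho>) \<le> packing_load B (Suc n) e"
proof -
  \<comment> \<open>With this choice the bound on \<open>k\<close> makes \<open>ln (card E)\<close>
    at most an \<open>\<epsilon> / 5\<close> fraction of \<open>k * (\<delta> / \<rho>)\<close>, as
    20 = 4 * 5.\<close>
  define \<delta> where "\<delta> = \<epsilon> / 4"
  define k where "k = real (Suc n)"
  define l where "l = real (L (Suc n) e)"
  have \<delta>: "0 < \<delta>" "\<delta> < 1" using \<epsilon> by (auto simp: \<delta>_def)
  have \<rho>: "1 \<le> \<rho>" by (rule density_ge_1)
  have m: "0 < real (card E)" using card_ground_pos by simp
  have "(1 - \<delta>) ^ L (Suc n) e \<le> (\<Sum>e\<in>Es (Suc n). (1 - \<delta>) ^ L (Suc n) e)"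
    using e \<delta> finite_subset[OF Es_subset finite_ground]
    by (intro member_le_sum[where f = "\<lambda>e. (1 - \<delta>) ^ L (Suc n) e"]) auto
  also have "\<dots> \<le> real (card E) * (1 - \<delta> / \<rho>) ^ Suc n"
    using \<delta> by (intro low_potential) auto
  also have "\<dots> \<le> real (card E) * exp (- (\<delta> / \<rho>)) ^ Suc n"
    using \<delta> \<rho> exp_ge_add_one_self[of "- (\<delta> / \<rho>)"]
    by (intro mult_left_mono power_mono) auto
  finally have "ln ((1 - \<delta>) ^ L (Suc n) e) \<le> ln (real (card E) * exp (- (\<delta> / \<rho>)) ^ Suc n)"
    using \<delta> m by (subst ln_le_cancel_iff) auto
  then have 1: "l * ln (1 - \<delta>) \<le> ln (real (card E)) - k * (\<delta> / \<rho>)"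
    using \<delta> m by (simp add: ln_realpow ln_mult_pos l_def k_def del: power_Suc)
  \<comment> \<open>This is \<open>ln x \<le> x - 1\<close> at
    \<open>x = 1 / (1 - \<delta>)\<close>.\<close>
  have "- (\<delta> / (1 - \<delta>)) \<le> ln (1 - \<delta>)"
    using ln_le_minus_one[of "1 / (1 - \<delta>)"] \<delta> by (simp add: ln_div field_simps)
  then have "l * - (\<delta> / (1 - \<delta>)) \<le> l * ln (1 - \<delta>)"
    by (rule mult_left_mono) (simp add: l_def)
  with 1 have 2: "k * (\<delta> / \<rho>) - ln (real (card E)) \<le> l * (\<delta> / (1 - \<delta>))"
    by simp
  have "ln (real (card E)) \<le> k * (\<delta> / \<rho>) * (\<epsilon> / 5)"
    using k \<epsilon> \<rho> by (simp add: k_def \<delta>_def field_simps power2_eq_square)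
  with 2 have "(k * (\<delta> / \<rho>)) * (1 - \<epsilon> / 5) \<le> l * (\<delta> / (1 - \<delta>))"
    by (simp add: right_diff_distrib)
  then have "(k * (\<delta> / \<rho>)) * (1 - \<epsilon> / 5) * ((1 - \<delta>) * \<rho> / \<delta>)
      \<le> l * (\<delta> / (1 - \<delta>)) * ((1 - \<delta>) * \<rho> / \<delta>)"
    using \<delta> \<rho> by (intro mult_right_mono) auto
  then have 3: "k * (1 - \<epsilon> / 5) * (1 - \<delta>) \<le> l * \<rho>"
    using \<delta> \<rho> by simp
  \<comment> \<open>This is 20 times the excess over 1 of \<open>(1 - \<epsilon> / 5) * (1 -
    \<epsilon> / 4) * (1 + \<epsilon>)\<close>.\<close>
  have "0 \<le> \<epsilon> * (11 - 8 * \<epsilon> + \<epsilon> * \<epsilon>)"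
    using \<epsilon> by (intro mult_nonneg_nonneg add_nonneg_nonneg) auto
  then have "1 \<le> (1 - \<epsilon> / 5) * (1 - \<delta>) * (1 + \<epsilon>)"
    by (simp add: \<delta>_def field_simps)
  then have "k * 1 \<le> k * ((1 - \<epsilon> / 5) * (1 - \<delta>) * (1 + \<epsilon>))"
    by (intro mult_left_mono) (auto simp: k_def)
  also have "\<dots> = k * (1 - \<epsilon> / 5) * (1 - \<delta>) * (1 + \<epsilon>)" by simp
  also have "\<dots> \<le> l * \<rho> * (1 + \<epsilon>)"
    using 3 \<epsilon> by (intro mult_right_mono) auto
  finally have "k \<le> l * ((1 + \<epsilon>) * \<rho>)" by (simp add: mult_ac)
  moreover have "0 < k" "0 < (1 + \<epsilon>) * \<rho>"
    using \<epsilon> \<rho> by (auto simp: k_def)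
  ultimately have "1 / ((1 + \<epsilon>) * \<rho>) \<le> l / k"
    by (simp add: pos_divide_le_eq pos_le_divide_eq mult.commute)
  then show ?thesis by (simp add: packing_load_eq l_def k_def)
qed

text \<open>Survival and the potential bound are proved together: the growth estimate for a round
  needs \<open>U\<close> inside the current ground set, and the resulting bound rules out pruning
  any element of \<open>U\<close> after that round.\<close>

lemma densest_survives:
  assumes U: "U \<subseteq> E" "U \<noteq> {}" "real (card U) / real (matroid_rank \<I> U) = \<rho>"
  shows "U \<subseteq> Es (Suc n)"
proof -
  have \<rho>: "1 \<le> \<rho>" by (rule density_ge_1)
  have tight: "1 / \<rho> * real (card U) = real (matroid_rank \<I> U)"
    using U rank_pos[of U] \<rho> by (auto simp: field_simps)
  have finU: "finite U" using U finite_ground finite_subset by blast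
  have "U \<subseteq> Es (Suc n) \<and> (\<Sum>e\<in>U. 2 ^ L n e) \<le> real (card E) * (1 + 1 / \<rho>) ^ n"
  proof (induction n)
    case 0
    then show ?case
      using U finite_ground by (simp add: Es_1 card_mono)
  next
    case (Suc n)
    have "(\<Sum>e\<in>U. of_bool (e \<in> B (Suc n)) * 2 ^ L n e) \<le> 1 / \<rho> * (\<Sum>e\<in>U. 2 ^ L n e)"
      using Suc U
      by (intro min_weight_base_monotone_sum[OF B_min Es_subset] card_le_density tight)
        (auto intro!: packing_load_less)
    then have "(\<Sum>e\<in>U. (2::real) ^ L (Suc n) e) \<le> (1 + 1 / \<rho>) * (\<Sum>e\<in>U. 2 ^ L n e)"
      by (simp add: potential_Suc algebra_simps)
    also have "\<dots> \<le> (1 + 1 / \<rho>) * (real (card E) * (1 + 1 / \<rho>) ^ n)"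
      using Suc \<rho> by (intro mult_left_mono) auto
    finally have pot: "(\<Sum>e\<in>U. (2::real) ^ L (Suc n) e) \<le> real (card E) * (1 + 1 / \<rho>) ^ Suc n"
      by (simp add: mult_ac)
    have "e \<in> Es (Suc (Suc n))" if e: "e \<in> U" for e
    proof (rule ccontr)
      assume "e \<notin> Es (Suc (Suc n))"
      with Suc e have pruned: "2 / \<rho> < packing_load B (Suc n) e"
          "24 * \<rho> * ln (real (card E)) \<le> real (Suc n)"
        using pruned_imp[of e n] by auto
      have m: "0 < real (card E)" using card_ground_pos by simp
      have "(2::real) ^ L (Suc n) e \<le> (\<Sum>e\<in>U. 2 ^ L (Suc n) e)"
        using e finU by (intro member_le_sum[where f = "\<lambda>e. (2::real) ^ L (Suc n) e"]) auto
      also note pot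
      also have "real (card E) * (1 + 1 / \<rho>) ^ Suc n \<le> real (card E) * exp (1 / \<rho>) ^ Suc n"
        using \<rho> exp_ge_add_one_self[of "1 / \<rho>"] by (intro mult_left_mono power_mono) auto
      finally have "ln ((2::real) ^ L (Suc n) e) \<le> ln (real (card E) * exp (1 / \<rho>) ^ Suc n)"
        using m by (subst ln_le_cancel_iff) auto
      then have 1: "real (L (Suc n) e) * ln 2 \<le> ln (real (card E)) + real (Suc n) * (1 / \<rho>)"
        using m by (simp add: ln_realpow ln_mult_pos del: power_Suc)
      \<comment> \<open>Pruning \<open>e\<close> would give \<open>2 * y < L (Suc n) e\<close> and
        \<open>ln (card E) \<le> y / 24\<close>. With \<open>ln 2 \<ge> 2 / 3\<close> this yields
        \<open>4 / 3 * y < 25 / 24 * y\<close>, which is impossible for positive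
        \<open>y\<close>.\<close>
      define y where "y = real (Suc n) * (1 / \<rho>)"
      have "real (L (Suc n) e) * (2 / 3) \<le> real (L (Suc n) e) * ln 2"
        using ln2_ge_two_thirds by (intro mult_left_mono) auto
      with 1 have "real (L (Suc n) e) * (2 / 3) \<le> ln (real (card E)) + y"
        unfolding y_def by linarith
      moreover have "ln (real (card E)) \<le> y / 24"
        using pruned(2) \<rho> by (simp add: y_def field_simps)
      moreover have "2 * y < real (L (Suc n) e)"
        using pruned(1) \<rho> by (simp add: y_def packing_load_eq field_simps)
      moreover have "0 < y"
        using \<rho> by (simp add: y_def)
      ultimately show False by linarith
    qed
    with pot show ?case by blast
  qed
  then show ?thesis by simp
qed

text \<open>Shrinking the ground set cannot raise the maximum, and a densest set of \<open>E\<close>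
  is still available to attain it.\<close>

lemma density_invariant: "matroid_density (Es (Suc n)) (restrict_indep \<I> (Es (Suc n))) = \<rho>"
proof -
  have fin: "finite (Es (Suc n))"
    using finite_subset[OF Es_subset finite_ground] .
  obtain U where U: "U \<noteq> {}" "U \<subseteq> E" "real (card U) / real (matroid_rank \<I> U) = \<rho>"
    using density_attained[OF finite_ground nonempty, of \<I>] density by metis
  have UE: "U \<subseteq> Es (Suc n)"
    using U by (intro densest_survives)
  obtain H where H: "H \<noteq> {}" "H \<subseteq> Es (Suc n)"
    "real (card H) / real (matroid_rank \<I> H) = matroid_density (Es (Suc n)) \<I>"
    using density_attained[OF fin, of \<I>] U UE by blast
  have "matroid_density (Es (Suc n)) \<I> \<le> \<rho>"
    using density_ge[OF finite_ground, of H \<I>] H Es_subset[of n] density by auto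
  moreover have "\<rho> \<le> matroid_density (Es (Suc n)) \<I>"
    using density_ge[OF fin, of U \<I>] U UE by auto
  ultimately show ?thesis by (simp add: density_restrict)
qed

text \<open>An averaging argument on a surviving densest \<open>U\<close>: each base meets
  \<open>U\<close> in at most \<open>matroid_rank \<I> U\<close> elements, so the average load on
  \<open>U\<close> is at most rank over size, that is \<open>1 / \<rho>\<close>.\<close>

lemma low_load_exists: "\<exists>e\<in>Es (Suc n). packing_load B (Suc n) e \<le> 1 / \<rho>"
proof (rule ccontr)
  assume "\<not> ?thesis"
  then have high: "1 / \<rho> < packing_load B (Suc n) e" if "e \<in> Es (Suc n)" for e
    using that by force
  obtain U where U: "U \<noteq> {}" "U \<subseteq> E" "real (card U) / real (matroid_rank \<I> U) = \<rho>"
    using density_attained[OF finite_ground nonempty, of \<I>] density by metis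
  have UE: "U \<subseteq> Es (Suc n)"
    using U by (intro densest_survives)
  have finU: "finite U" using U finite_ground finite_subset by blast
  have "(\<Sum>e\<in>U. real (Suc n) / \<rho>) < (\<Sum>e\<in>U. real (L (Suc n) e))"
    using high UE density_ge_1
    by (intro sum_strict_mono finU U(1)) (force simp: packing_load_eq field_simps)
  also have "\<dots> = real (\<Sum>e\<in>U. L (Suc n) e)" by simp
  also have "\<dots> \<le> real (Suc n * matroid_rank \<I> U)"
    using sum_multiplicity_count_le[OF finU B_indep] by (subst of_nat_le_iff)
  also have "\<dots> = (\<Sum>e\<in>U. real (Suc n) / \<rho>)"
    using U rank_pos[of U] density_ge_1 by (auto simp: field_simps)
  finally show False by simp
qed

lemma min_load_approx:
  assumes "0 < \<epsilon>" "\<epsilon> \<le> 1" "20 * \<rho> * ln (real (card E)) / \<epsilon>\<^sup>2 \<le> real (Suc n)"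
  shows "0 \<le> 1 / Min (packing_load B (Suc n) ` Es (Suc n)) - \<rho>"
    and "1 / Min (packing_load B (Suc n) ` Es (Suc n)) - \<rho> \<le> \<epsilon> * \<rho>"
proof -
  define \<mu> where "\<mu> = Min (packing_load B (Suc n) ` Es (Suc n))"
  have fin: "finite (Es (Suc n))"
    using finite_subset[OF Es_subset finite_ground] .
  obtain e where e: "e \<in> Es (Suc n)" "packing_load B (Suc n) e \<le> 1 / \<rho>"
    using low_load_exists by blast
  have "1 / ((1 + \<epsilon>) * \<rho>) \<le> \<mu>"
    unfolding \<mu>_def using fin e assms by (subst Min_ge_iff) (auto intro: load_lower_bound)
  moreover have "\<mu> \<le> 1 / \<rho>"
    unfolding \<mu>_def using fin e by (subst Min_le_iff) auto
  moreover have "0 < 1 / ((1 + \<epsilon>) * \<rho>)"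
    using assms density_ge_1 by simp
  \<comment> \<open>Positivity of the minimum load makes taking reciprocals order-reversing, which
    turns the two bounds on \<open>\<mu>\<close> into the claim.\<close>
  moreover from calculation have "0 < \<mu>" by linarith
  ultimately have "1 / \<mu> \<le> 1 / (1 / ((1 + \<epsilon>) * \<rho>))" "1 / (1 / \<rho>) \<le> 1 / \<mu>"
    by (intro frac_le; simp)+
  then have "\<rho> \<le> 1 / \<mu>" "1 / \<mu> \<le> (1 + \<epsilon>) * \<rho>"
    by simp_all
  then show "0 \<le> 1 / Min (packing_load B (Suc n) ` Es (Suc n)) - \<rho>"
    and "1 / Min (packing_load B (Suc n) ` Es (Suc n)) - \<rho> \<le> \<epsilon> * \<rho>"
    by (auto simp: \<mu>_def distrib_right)
qed

end

theorem theorem9: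
  fixes E :: "'a set" and \<I> :: "'a set set"
    and m :: nat and \<rho> :: real and lo hi :: ereal
    and Es B :: "nat \<Rightarrow> 'a set"
  assumes "matroid E \<I>"
    and "m = card E" and "m \<ge> 1"
    and "\<not> (\<exists>e. matroid_loop E \<I> e)"
    and "\<rho> = matroid_density E \<I>"
    and "0 \<le> lo" and "lo \<le> hi"
    and "lo \<le> ereal \<rho>" and "ereal \<rho> \<le> hi"
    and "pruned_greedy_packing E \<I> lo hi Es B"
  shows "(\<forall>k\<ge>1. matroid_density (Es k) (restrict_indep \<I> (Es k)) = \<rho>) \<and>
    (\<forall>(\<epsilon>::real) (k::nat). 0 < \<epsilon> \<longrightarrow> \<epsilon> \<le> 1 \<longrightarrow> k \<ge> 1 \<longrightarrow> real k \<ge> 20 * \<rho> * ln (real m) / \<epsilon>\<^sup>2 \<longrightarrow>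
       0 \<le> 1 / Min (packing_load B k ` Es k) - \<rho> \<and>
       1 / Min (packing_load B k ` Es k) - \<rho> \<le> \<epsilon> * \<rho>)"
proof -
  interpret matroid E \<I> by fact
  interpret pruned_packing E \<I> \<rho> lo hi Es B
    by unfold_locales (use assms in \<open>auto simp: matroid_loop_def\<close>)
  show ?thesis
  proof (intro conjI allI impI)
    fix k :: nat assume "1 \<le> k"
    then show "matroid_density (Es k) (restrict_indep \<I> (Es k)) = \<rho>"
      using density_invariant[of "k - 1"] by simp
  next
    fix \<epsilon> :: real and k :: nat
    assume *: "0 < \<epsilon>" "\<epsilon> \<le> 1" "1 \<le> k" "20 * \<rho> * ln (real m) / \<epsilon>\<^sup>2 \<le> real k"
    then obtain n where n: "k = Suc n" using not0_implies_Suc by fastforce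
    show "0 \<le> 1 / Min (packing_load B k ` Es k) - \<rho>"
      "1 / Min (packing_load B k ` Es k) - \<rho> \<le> \<epsilon> * \<rho>"
      using min_load_approx[of \<epsilon> n] * assms(2) unfolding n by auto
  qed
qed

end
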